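(* Let $\alpha=\frac1b$ with $b\in\mathbb{N}$, and let $k^t,k^d\in\mathbb{N}$ satisfy $k^t\ge\left\lceil\frac{k^d}{k^t}\right\rceil+b-1$. There is an instance $I$ of the relief distribution problem with $k^t$ trucks, $k^d$ drones and drone speed $\alpha$ such that $$\frac{\mathrm{Regretless}(I)}{\mathrm{OPT}(I^* )}=1+\alpha\left\lceil\frac{k^d}{k^t}\right\rceil.$$
   Context: Relief distribution problem (RDP). $\mathbb{N}=\{1,2,\dots\}$. An instance is $I=(k^t,k^d,\alpha,G,D)$: $k^t,k^d\in\mathbb{N}$ are the numbers of trucks and drones; $\alpha>0$ is the drone speed; $G=(V,E,c)$ is a finite connected undirected graph (not necessarily complete) with $V=\{v_0\}\cup C$, where $v_0$ is the depot and $C\neq\emptyset$ is the set of non-depot nodes; edge lengths $c(i,j)>0$ satisfy the triangle inequality; $D\subseteq C$ is the set of damaged nodes, initially unknown; the status of a node is revealed (instantly to all) when some vehicle first arrives at it. For non-adjacent $i,j$, $c(i,j)$ is the shortest-path distance. A truck needs time $c(i,j)$ to traverse an edge, a drone needs $\frac1\alpha c(i,j)$. A tour is a closed walk in $G$ starting and ending at $v_0$ (possibly of length $0$); it may be written as a sequence of nodes, consecutive nodes being joined by shortest paths, and $c(t)$ is the length of tour $t$. The makespan of a family of tours is the maximum duration of a tour. Full-information optimum: $\mathrm{OPT}(I^* )$ is the minimum makespan over all families of $k^t$ truck tours and $k^d$ drone tours such that every node of $C$ is visited by some vehicle and every node of $D$ is visited by a truck ($I^*$ is the instance $I$ with $D$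 known in advance). For integers $m,n\ge 0$ with $m+n\ge1$ and $W\subseteq C$, $S^*_{m,n}(W)$ denotes a family of $m$ truck tours and $n$ drone tours together visiting all nodes of $W$ with minimum makespan. Policy Regretless (deterministic; choices among optimal solutions are made by a fixed rule using only the information available at that time, so first-stage decisions do not depend on $D$). First stage: compute $S^*_{k^t,0}(C)=\{s^*_1,\dots,s^*_{k^t}\}$, written as $s^*_i=(v_0,v_{(1)},\dots,v_{(n_i)},v_0)$ so that each node of $C$ is listed exactly once in exactly one tour. Assign one truck to each tour and distribute the drones as evenly as possible, so each tour receives $\lceil k^d/k^t\rceil$ or $\lfloor k^d/k^t\rfloor$ drones; let $k_i$ be the number of vehicles assigned to $s_i^*$. Split $(v_{(1)},\dots,v_{(n_i)})$ into up to $k_i$ consecutive nonempty segments $\Delta_i^l=(v_{(j_l)},\dots,v_{(j_{l+1}-1)})$, $j_1=1$; the truck is assigned the tour $t_i^1=(v_0,v_{(1)},\dots,v_{(j_2-1)},v_0)$ and each further segment $l\ge2$ is assigned to one drone, with the reversed tour $t_i^l=(v_0,v_{(j_{l+1}-1)},\dots,v_{(j_l)},v_0)$; the splitting is chosen to minimize $\max\{c(t_i^1),\max_{l\ge2} c(t_i^l)/\alpha\}$. All vehicles start at time $0$. Second stage (replanning), for each $i$: when truck $i$ reaches the last node $v_{(j_2-1)}$ of its segment, let $D_i^d$ be the set of damaged nodes of $s_i^*$ not yet visited by the truck and $C_i^d$ the set of nodes of $s_i^*$ not yet visited by any vehicle; the truck then follows a minimum-length walk from its current node visiting all of $D_i^d\cup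 C_i^d$ and ending at $v_0$. The drones complete their tours. $\mathrm{Regretless}(I)$ is the time at which the last vehicle has returned to $v_0$. *)

theory Defs
  imports Complex_Main
begin

text \<open>Simple undirected graphs with a depot; \<open>nodes G\<close> is the set of non-depot nodes.
  The length function is only meaningful on \<open>edges G\<close>.\<close>

record 'v network =
  depot :: 'v
  nodes :: "'v set"
  edges :: "'v set set"
  elen :: "'v set \<Rightarrow> real"

definition verts :: "'v network \<Rightarrow> 'v set" where
  "verts G = insert (depot G) (nodes G)"

definition walk :: "'v network \<Rightarrow> 'v list \<Rightarrow> bool" where
  "walk G w \<longleftrightarrow> w \<noteq> [] \<and> set w \<subseteq> verts G \<and> successively (\<lambda>x y. {x, y} \<in> edges G) w"

definition walk_betw :: "'v network \<Rightarrow> 'v \<Rightarrow> 'v \<Rightarrow> 'v list \<Rightarrow> bool" where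
  "walk_betw G u v w \<longleftrightarrow> walk G w \<and> hd w = u \<and> last w = v"

definition walk_len :: "'v network \<Rightarrow> 'v list \<Rightarrow> real" where
  "walk_len G w = sum_list (map2 (\<lambda>x y. elen G {x, y}) w (tl w))"

definition tour :: "'v network \<Rightarrow> 'v list \<Rightarrow> bool" where
  "tour G w \<longleftrightarrow> walk_betw G (depot G) (depot G) w"

definition shortest_path :: "'v network \<Rightarrow> 'v \<Rightarrow> 'v \<Rightarrow> 'v list \<Rightarrow> bool" where
  "shortest_path G u v p \<longleftrightarrow> is_arg_min (walk_len G) (walk_betw G u v) p"

definition cost :: "'v network \<Rightarrow> 'v \<Rightarrow> 'v \<Rightarrow> real" where
  "cost G i j = (if {i, j} \<in> edges G then elen G {i, j}
                 else (LEAST d. \<exists>w. walk_betw G i j w \<and> d = walk_len G w))"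

definition seq_len :: "'v network \<Rightarrow> 'v list \<Rightarrow> real" where
  "seq_len G xs = sum_list (map2 (cost G) xs (tl xs))"

text \<open>\<open>realizes G w xs\<close>: the walk \<open>w\<close> arises from the node sequence \<open>xs\<close> by joining consecutive
  nodes by shortest paths. Two equal consecutive nodes are joined by the walk of length 0, so the
  sequence (depot, depot) stands for the tour that stays at the depot.\<close>

inductive realizes :: "'v network \<Rightarrow> 'v list \<Rightarrow> 'v list \<Rightarrow> bool" for G where
  single: "x \<in> verts G \<Longrightarrow> realizes G [x] [x]"
| step: "shortest_path G x y p \<Longrightarrow> realizes G w (y # ys) \<Longrightarrow> realizes G (p @ tl w) (x # y # ys)"

text \<open>The triangle inequality is required of \<open>cost\<close> on all triples of vertices, adjacent or not;
  in particular every edge is a shortest path between its ends.\<close>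

definition valid_network :: "'v network \<Rightarrow> bool" where
  "valid_network G \<longleftrightarrow>
     finite (nodes G) \<and> nodes G \<noteq> {} \<and> depot G \<notin> nodes G \<and>
     (\<forall>e \<in> edges G. \<exists>i \<in> verts G. \<exists>j \<in> verts G. i \<noteq> j \<and> e = {i, j}) \<and>
     (\<forall>e \<in> edges G. elen G e > 0) \<and>
     (\<forall>u \<in> verts G. \<forall>v \<in> verts G. \<exists>w. walk_betw G u v w) \<and>
     (\<forall>i \<in> verts G. \<forall>j \<in> verts G. \<forall>k \<in> verts G. cost G i k \<le> cost G i j + cost G j k)"

text \<open>A \<open>setting\<close> is the part of an instance that is known from the beginning.\<close>

record 'v setting =
  trucks :: nat
  drones :: nat
  speed :: real
  network :: "'v network"

record 'v rdp_instance =
  setting :: "'v setting"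
  damaged :: "'v set"

definition valid_setting :: "'v setting \<Rightarrow> bool" where
  "valid_setting S \<longleftrightarrow> trucks S \<ge> 1 \<and> drones S \<ge> 1 \<and> speed S > 0 \<and> valid_network (network S)"

definition valid_instance :: "'v rdp_instance \<Rightarrow> bool" where
  "valid_instance I \<longleftrightarrow>
     valid_setting (setting I) \<and> damaged I \<subseteq> nodes (network (setting I))"

text \<open>Families are pairs of a list of truck tours and a list of drone tours.\<close>

definition family :: "'v network \<Rightarrow> nat \<Rightarrow> nat \<Rightarrow> 'v list list \<times> 'v list list \<Rightarrow> bool" where
  "family G m n F \<longleftrightarrow>
     length (fst F) = m \<and> length (snd F) = n \<and> (\<forall>w \<in> set (fst F) \<union> set (snd F). tour G w)"

definition makespan :: "'v network \<Rightarrow> real \<Rightarrow> 'v list list \<times> 'v list list \<Rightarrow> real" where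
  "makespan G \<alpha> F =
     Max (walk_len G ` set (fst F) \<union> (\<lambda>w. walk_len G w / \<alpha>) ` set (snd F))"

definition visits :: "'v list list \<Rightarrow> 'v set" where
  "visits ws = (\<Union>w \<in> set ws. set w)"

definition OPT :: "'v rdp_instance \<Rightarrow> real" where
  "OPT I = (let S = setting I; G = network S in
     LEAST T. \<exists>F. family G (trucks S) (drones S) F \<and>
       nodes G \<subseteq> visits (fst F) \<union> visits (snd F) \<and> damaged I \<subseteq> visits (fst F) \<and>
       T = makespan G (speed S) F)"

definition optimal_family ::
  "'v network \<Rightarrow> real \<Rightarrow> nat \<Rightarrow> nat \<Rightarrow> 'v set \<Rightarrow> 'v list list \<times> 'v list list \<Rightarrow> bool" where
  "optimal_family G \<alpha> m n W F \<longleftrightarrow>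
     is_arg_min (makespan G \<alpha>) (\<lambda>F. family G m n F \<and> W \<subseteq> visits (fst F) \<union> visits (snd F)) F"

text \<open>A splitting of a tour is the list of its segments. The first one belongs to the truck; it is
  empty only for a tour without nodes. Drones without a segment stay at the depot.\<close>

definition splitting :: "nat \<Rightarrow> 'v list \<Rightarrow> 'v list list \<Rightarrow> bool" where
  "splitting k vs \<Delta> \<longleftrightarrow> concat \<Delta> = vs \<and> [] \<notin> set \<Delta> \<and> length \<Delta> \<le> k"

definition truck_segment :: "'v list list \<Rightarrow> 'v list" where
  "truck_segment \<Delta> = (case \<Delta> of [] \<Rightarrow> [] | s # _ \<Rightarrow> s)"

definition drone_segments :: "'v list list \<Rightarrow> 'v list list" where
  "drone_segments \<Delta> = tl \<Delta>"

definition splitting_cost :: "'v network \<Rightarrow> real \<Rightarrow> 'v list list \<Rightarrow> real" where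
  "splitting_cost G \<alpha> \<Delta> =
     Max (insert (seq_len G (depot G # truck_segment \<Delta> @ [depot G]))
            ((\<lambda>s. seq_len G (depot G # rev s @ [depot G]) / \<alpha>) ` set (drone_segments \<Delta>)))"

text \<open>First-stage decisions. For tour number \<open>i\<close>: \<open>listing ! i\<close> is the sequence of its nodes without
  the depot, \<open>drone_num ! i\<close> the number of its drones, \<open>segments ! i\<close> its splitting,
  \<open>truck_out ! i\<close> the walk of its truck up to the last node of the truck segment, and
  \<open>drone_walks ! i\<close> the walks of its drones that have a segment.\<close>

record 'v plan =
  listing :: "'v list list"
  drone_num :: "nat list"
  segments :: "'v list list list"
  truck_out :: "'v list list"
  drone_walks :: "'v list list list"

definition first_stage :: "'v setting \<Rightarrow> 'v plan \<Rightarrow> bool" where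
  "first_stage S P \<longleftrightarrow> (let G = network S; kt = trucks S; kd = drones S in
     length (listing P) = kt \<and> length (drone_num P) = kt \<and> length (segments P) = kt \<and>
     length (truck_out P) = kt \<and> length (drone_walks P) = kt \<and>
     distinct (concat (listing P)) \<and> set (concat (listing P)) = nodes G \<and>
     (\<exists>ts. optimal_family G (speed S) kt 0 (nodes G) (ts, []) \<and>
        (\<forall>i<kt. realizes G (ts ! i) (depot G # listing P ! i @ [depot G]))) \<and>
     sum_list (drone_num P) = kd \<and>
     (\<forall>i<kt. int (drone_num P ! i) \<in> {\<lceil>real kd / real kt\<rceil>, \<lfloor>real kd / real kt\<rfloor>}) \<and>
     (\<forall>i<kt. is_arg_min (splitting_cost G (speed S))
                (splitting (1 + drone_num P ! i) (listing P ! i)) (segments P ! i)) \<and>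
     (\<forall>i<kt. realizes G (truck_out P ! i) (depot G # truck_segment (segments P ! i))) \<and>
     (\<forall>i<kt. list_all2 (\<lambda>w s. realizes G w (depot G # rev s @ [depot G]))
                (drone_walks P ! i) (drone_segments (segments P ! i))))"

text \<open>The second-stage rule of a policy gets the setting, the number of the replanning truck, the set
  of nodes visited so far by some vehicle, and the set of damaged nodes among these; as the policy is
  deterministic, this determines everything observed so far.\<close>

record 'v policy =
  first :: "'v setting \<Rightarrow> 'v plan"
  second :: "'v setting \<Rightarrow> nat \<Rightarrow> 'v set \<Rightarrow> 'v set \<Rightarrow> 'v list"

definition replan_time :: "'v policy \<Rightarrow> 'v setting \<Rightarrow> nat \<Rightarrow> real" where
  "replan_time R S i = walk_len (network S) (truck_out (first R S) ! i)"

definition visited_until :: "'v network \<Rightarrow> real \<Rightarrow> real \<Rightarrow> 'v list \<Rightarrow> 'v set" where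
  "visited_until G \<sigma> t w = {w ! n |n. n < length w \<and> walk_len G (take (Suc n) w) / \<sigma> \<le> t}"

text \<open>The nodes visited by any vehicle until truck \<open>i\<close> replans. Trucks that do not replan strictly
  earlier are still on their first-stage walks at that time, so only those replanning earlier
  contribute second-stage walks.\<close>

function visited_at_replan :: "'v policy \<Rightarrow> 'v rdp_instance \<Rightarrow> nat \<Rightarrow> 'v set" where
  "visited_at_replan R I i =
    (let S = setting I; G = network S; P = first R S; t = replan_time R S i in
     (\<Union>j<trucks S. visited_until G 1 t (truck_out P ! j)) \<union>
     (\<Union>j<trucks S. \<Union>w \<in> set (drone_walks P ! j). visited_until G (speed S) t w) \<union>
     (\<Union>j \<in> {j. j < trucks S \<and> replan_time R S j < replan_time R S i}.
        visited_until G 1 t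
          (truck_out P ! j @
             tl (second R S j (visited_at_replan R I j) (damaged I \<inter> visited_at_replan R I j)))))"
  by pat_completeness auto
termination
proof -
  have "card {j. j < n \<and> f j < f k} < card {j. j < n \<and> f j < f i}"
    if "k < n" "f k < f i" for f :: "nat \<Rightarrow> real" and n k i
    by (rule psubset_card_mono) (use that in \<open>auto intro: less_trans\<close>)
  then show ?thesis
    by (relation "measure (\<lambda>(R, I, i). card {j. j < trucks (setting I) \<and>
          replan_time R (setting I) j < replan_time R (setting I) i})") auto
qed

declare visited_at_replan.simps [simp del]

definition second_walk :: "'v policy \<Rightarrow> 'v rdp_instance \<Rightarrow> nat \<Rightarrow> 'v list" where
  "second_walk R I i =
     second R (setting I) i (visited_at_replan R I i) (damaged I \<inter> visited_at_replan R I i)"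

definition missing_damaged :: "'v policy \<Rightarrow> 'v rdp_instance \<Rightarrow> nat \<Rightarrow> 'v set" where
  "missing_damaged R I i = (let P = first R (setting I) in
     {v \<in> set (listing P ! i). v \<in> damaged I \<and> v \<notin> set (truck_out P ! i)})"

definition missing_unvisited :: "'v policy \<Rightarrow> 'v rdp_instance \<Rightarrow> nat \<Rightarrow> 'v set" where
  "missing_unvisited R I i = set (listing (first R (setting I)) ! i) - visited_at_replan R I i"

definition second_stage :: "'v policy \<Rightarrow> 'v rdp_instance \<Rightarrow> nat \<Rightarrow> bool" where
  "second_stage R I i \<longleftrightarrow> (let S = setting I; G = network S in
     is_arg_min (walk_len G)
       (\<lambda>w. walk_betw G (last (truck_out (first R S) ! i)) (depot G) w \<and>
            missing_damaged R I i \<union> missing_unvisited R I i \<subseteq> set w)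
       (second_walk R I i))"

text \<open>The implementations of Regretless; they differ in how ties between optimal choices are broken.
  Neither \<open>first\<close> nor \<open>second\<close> has access to damaged nodes that are not yet revealed.\<close>

definition regretless_policy :: "'v policy \<Rightarrow> bool" where
  "regretless_policy R \<longleftrightarrow>
     (\<forall>S. valid_setting S \<longrightarrow> first_stage S (first R S)) \<and>
     (\<forall>I. valid_instance I \<longrightarrow> (\<forall>i<trucks (setting I). second_stage R I i))"

definition Regretless :: "'v policy \<Rightarrow> 'v rdp_instance \<Rightarrow> real" where
  "Regretless R I = (let S = setting I; G = network S; P = first R S in
     Max ((\<lambda>i. walk_len G (truck_out P ! i @ tl (second_walk R I i))) ` {..<trucks S} \<union>
          (\<lambda>w. walk_len G w / speed S) ` (\<Union>i<trucks S. set (drone_walks P ! i))))"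

end

theory Submission
  imports Defs
begin

text \<open>Let \<open>m = \<lceil>kd / kt\<rceil>\<close> and take \<open>kt * (b + m - 1) + 1\<close> nodes whose distances are those between
  the leaves of a star with centre at the depot and rays of length \<open>1 / 2\<close>. The length of a tour is
  then the number of its non-depot stops. Without drones some truck needs \<open>b + m\<close> stops, and no truck
  needs more. Damage exactly those nodes of a longest listed tour that its truck does not reach in
  the first stage: wherever the tour was split, its truck makes all \<open>b + m\<close> stops in the end. With
  full information makespan \<open>b\<close> suffices: each truck makes \<open>b\<close> stops, each drone one, and the at
  most \<open>b + m - 1 \<le> kt\<close> damaged nodes are given to the trucks.\<close>

section \<open>Walks in an arbitrary network\<close>

lemma walk_len_simps [simp]:
  "walk_len G [] = 0"
  "walk_len G [x] = 0"
  "walk_len G (x # y # w) = elen G {x, y} + walk_len G (y # w)"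
  by (simp_all add: walk_len_def)

lemma walk_len_join:
  assumes "u \<noteq> []" "w \<noteq> []" "last u = hd w"
  shows "walk_len G (u @ tl w) = walk_len G u + walk_len G w"
  using assms
proof (induction u rule: induct_list012)
  case (2 x)
  then show ?case by (cases w) auto
qed auto

lemma walk_join:
  assumes "walk_betw G x y u" "walk_betw G y z w"
  shows "walk_betw G x z (u @ tl w)" "set (u @ tl w) = set u \<union> set w"
proof -
  obtain w' where w: "w = y # w'"
    using assms(2) by (cases w) (auto simp: walk_betw_def walk_def)
  then show "walk_betw G x z (u @ tl w)"
    using assms by (cases w') (auto simp: walk_betw_def walk_def successively_append_iff)
  have "y \<in> set u"
    using assms(1) by (auto simp: walk_betw_def walk_def)
  then show "set (u @ tl w) = set u \<union> set w"
    using w by auto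
qed

lemma realizes_walk:
  assumes "realizes G w xs"
  shows "walk_betw G (hd xs) (last xs) w" "set xs \<subseteq> set w"
proof -
  have "walk_betw G (hd xs) (last xs) w \<and> set xs \<subseteq> set w"
    using assms
  proof induction
    case (step x y p w ys)
    have p: "walk_betw G x y p"
      using step by (simp add: shortest_path_def is_arg_min_def)
    have "x \<in> set p"
      using p by (auto simp: walk_betw_def walk_def)
    then show ?case
      using walk_join[OF p, of "last (y # ys)" w] step by auto
  qed (auto simp: walk_betw_def walk_def)
  then show "walk_betw G (hd xs) (last xs) w" "set xs \<subseteq> set w" by auto
qed

section \<open>The star metric: lengths of walks and node sequences\<close>

text \<open>The graph is complete, carrying the star metric, so that \<open>cost\<close> is given directly by the edge
  lengths and walks need not pass through the depot.\<close>

definition stem :: "nat \<Rightarrow> real" where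
  "stem v = (if v = 0 then 0 else 1 / 2)"

definition star :: "nat \<Rightarrow> nat network" where
  "star N = \<lparr>depot = 0, nodes = {1..N}, edges = {{i, j} |i j. i \<le> N \<and> j \<le> N \<and> i \<noteq> j},
     elen = (\<lambda>e. \<Sum>v\<in>e. stem v)\<rparr>"

lemma star_sel [simp]: "depot (star N) = 0" "nodes (star N) = {1..N}"
  by (simp_all add: star_def)

lemma verts_star [simp]: "verts (star N) = {..N}"
  by (auto simp: verts_def)

lemma edges_star [simp]: "{i, j} \<in> edges (star N) \<longleftrightarrow> i \<le> N \<and> j \<le> N \<and> i \<noteq> j"
  by (auto simp: star_def doubleton_eq_iff)

lemma elen_star [simp]: "i \<noteq> j \<Longrightarrow> elen (star N) {i, j} = stem i + stem j"
  by (simp add: star_def)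

lemma stem_simps [simp]: "stem 0 = 0" "0 \<le> stem v"
  by (simp_all add: stem_def)

lemma walk_star: "walk (star N) w \<longleftrightarrow> w \<noteq> [] \<and> set w \<subseteq> {..N} \<and> successively (\<noteq>) w"
proof -
  have "successively (\<lambda>x y. {x, y} \<in> edges (star N)) w \<longleftrightarrow> successively (\<noteq>) w"
    if "set w \<subseteq> {..N}"
    by (rule successively_cong) (use that in auto)
  then show ?thesis by (auto simp: walk_def)
qed

text \<open>Each step pays the stems of both its ends, so every entry counts twice except the first
  and the last. The step cost \<open>c\<close> is kept general to serve both edge lengths along
  walks and \<open>cost\<close> along node sequences.\<close>

lemma sum_list_stems:
  assumes "xs \<noteq> []" "successively (\<lambda>x y. c x y = stem x + stem y) xs"
  shows "sum_list (map2 c xs (tl xs)) = 2 * (\<Sum>x\<leftarrow>xs. stem x) - stem (hd xs) - stem (last xs)"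
  using assms by (induction xs rule: induct_list012) auto

lemma walk_len_star:
  assumes "walk (star N) w"
  shows "walk_len (star N) w = 2 * (\<Sum>x\<leftarrow>w. stem x) - stem (hd w) - stem (last w)"
  unfolding walk_len_def
proof (rule sum_list_stems)
  show "successively (\<lambda>x y. elen (star N) {x, y} = stem x + stem y) w"
    by (rule successively_mono[of "(\<noteq>)"]) (use assms in \<open>auto simp: walk_star\<close>)
qed (use assms in \<open>auto simp: walk_star\<close>)

lemma sum_list_stem_nonneg: "0 \<le> (\<Sum>x\<leftarrow>xs. stem x)"
  by (rule sum_list_nonneg) auto

text \<open>Interior entries contribute nonnegative stems, so discarding them leaves the two ends; a
  walk with a single entry forces \<open>x = y\<close>.\<close>

lemma walk_len_star_ge:
  assumes "walk_betw (star N) x y w"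
  shows "walk_len (star N) w \<ge> (if x = y then 0 else stem x + stem y)"
proof (cases w)
  case (Cons z w')
  show ?thesis
  proof (cases w' rule: rev_cases)
    case (snoc w'' z')
    then show ?thesis
      using assms Cons walk_len_star[of N w] sum_list_stem_nonneg[of w'']
      by (auto simp: walk_betw_def)
  qed (use assms Cons in \<open>auto simp: walk_betw_def\<close>)
qed (use assms in \<open>auto simp: walk_betw_def walk_def\<close>)

lemma short_walk_star:
  assumes "x \<le> N" "y \<le> N"
  shows "\<exists>w. walk_betw (star N) x y w \<and> walk_len (star N) w = (if x = y then 0 else stem x + stem y)"
proof (cases "x = y")
  case True
  then show ?thesis
    using assms by (intro exI[of _ "[x]"]) (auto simp: walk_betw_def walk_star)
next
  case False
  then show ?thesis
    using assms by (intro exI[of _ "[x, y]"]) (auto simp: walk_betw_def walk_star)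
qed

lemma cost_star:
  assumes "x \<le> N" "y \<le> N"
  shows "cost (star N) x y = (if x = y then 0 else stem x + stem y)"
proof (cases "x = y")
  case True
  \<comment> \<open>There are no loops, so \<open>cost\<close> falls back on the least walk length,
    attained by the walk \<open>[x]\<close>.\<close>
  have "(LEAST d. \<exists>w. walk_betw (star N) x x w \<and> d = walk_len (star N) w) = 0"
    using short_walk_star[of x N x] walk_len_star_ge[of N x x] assms
    by (intro Least_equality) force+
  then show ?thesis
    using True edges_star[of x x N] by (simp add: cost_def)
qed (use assms in \<open>simp add: cost_def\<close>)

lemma shortest_path_star:
  assumes "shortest_path (star N) x y p"
  shows "walk_len (star N) p = cost (star N) x y"
proof -
  have p: "walk_betw (star N) x y p"
    and min: "\<And>w. walk_betw (star N) x y w \<Longrightarrow> walk_len (star N) p \<le> walk_len (star N) w"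
    using assms by (auto simp: shortest_path_def is_arg_min_linorder)
  have "x \<in> set p" "y \<in> set p" "set p \<subseteq> {..N}"
    using p by (auto simp: walk_betw_def walk_star)
  then have xy: "x \<le> N" "y \<le> N" by auto
  show ?thesis
    using short_walk_star[OF xy] walk_len_star_ge[OF p] cost_star[OF xy]
    by (metis antisym min)
qed

text \<open>Each joining piece is a shortest path and lengths add up under joining. Hence the length
  does not depend on which shortest paths are chosen.\<close>

lemma realizes_star:
  assumes "realizes (star N) w xs"
  shows "walk_len (star N) w = seq_len (star N) xs"
  using assms
proof induction
  case (step x y p w ys)
  have "walk_betw (star N) x y p"
    using step by (simp add: shortest_path_def is_arg_min_def)
  then have "walk_len (star N) (p @ tl w) = walk_len (star N) p + walk_len (star N) w"
    using realizes_walk(1)[OF step.hyps(2)]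
    by (intro walk_len_join) (auto simp: walk_betw_def walk_def)
  then show ?case
    using step shortest_path_star[OF step.hyps(1)] by (simp add: seq_len_def)
qed (simp add: seq_len_def)

lemma sum_list_stem_const:
  "0 \<notin> set xs \<Longrightarrow> (\<Sum>x\<leftarrow>xs. stem x) = real (length xs) / 2"
  by (induction xs) (auto simp: stem_def field_simps)

lemma distinct_successively_neq: "distinct xs \<Longrightarrow> successively (\<noteq>) xs"
  by (induction xs rule: induct_list012) auto

text \<open>Repeating the depot is harmless because its stem is 0; this admits the sequence
  \<open>[0, 0]\<close> of a truck without nodes.\<close>

lemma seq_len_star:
  assumes "xs \<noteq> []" "set xs \<subseteq> {..N}" "successively (\<lambda>x y. x = y \<longrightarrow> x = 0) xs"
  shows "seq_len (star N) xs = 2 * (\<Sum>x\<leftarrow>xs. stem x) - stem (hd xs) - stem (last xs)"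
  unfolding seq_len_def
proof (rule sum_list_stems)
  show "successively (\<lambda>x y. cost (star N) x y = stem x + stem y) xs"
    by (rule successively_mono[OF assms(3)]) (use assms(2) in \<open>auto simp: cost_star subset_iff\<close>)
qed (use assms in auto)

lemma seq_len_star_cycle:
  assumes "distinct xs" "set xs \<subseteq> {1..N}"
  shows "seq_len (star N) (0 # xs @ [0]) = real (length xs)"
proof -
  have "successively (\<lambda>x y. x = y \<longrightarrow> x = 0) xs"
    by (rule successively_mono[OF distinct_successively_neq[OF assms(1)]]) auto
  moreover have "0 \<notin> set xs" "xs \<noteq> [] \<Longrightarrow> last xs \<noteq> 0"
    using assms by (auto dest: last_in_set)
  ultimately show ?thesis
    using assms by (subst seq_len_star)
      (auto simp: sum_list_stem_const successively_append_iff successively_Cons subset_iff)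
qed

text \<open>Every node pays its stem 1/2 on arrival and on departure, except the last one, which is
  not left.\<close>

lemma seq_len_star_path:
  assumes "distinct xs" "set xs \<subseteq> {1..N}" "xs \<noteq> []"
  shows "seq_len (star N) (0 # xs) = real (length xs) - 1 / 2"
proof -
  have "successively (\<lambda>x y. x = y \<longrightarrow> x = 0) xs"
    by (rule successively_mono[OF distinct_successively_neq[OF assms(1)]]) auto
  moreover have "0 \<notin> set xs" "last xs \<noteq> 0"
    using assms last_in_set[of xs] by fastforce+
  ultimately show ?thesis
    using assms by (subst seq_len_star)
      (auto simp: sum_list_stem_const successively_Cons subset_iff stem_def[of "last xs"])
qed

text \<open>Each occurrence of a non-depot node in a closed walk at the depot costs twice its stem,
  that is 1, and each node of the set occurs at least once.\<close>

lemma star_tour_len_ge: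
  assumes "walk_betw (star N) 0 0 w"
  shows "real (card (set w - {0})) \<le> walk_len (star N) w"
proof -
  have "real (card (set w - {0})) = 2 * (\<Sum>x\<in>set w - {0}. stem x)"
    by (simp add: stem_def)
  also have "(\<Sum>x\<in>set w - {0}. stem x) = (\<Sum>x\<in>set w. stem x)"
    by (rule sum.mono_neutral_left) auto
  also have "\<dots> \<le> (\<Sum>x\<leftarrow>w. stem x)"
    by (induction w) (auto simp: sum.insert_if add_increasing)
  also have "2 * \<dots> = walk_len (star N) w"
    using assms by (subst walk_len_star) (auto simp: walk_betw_def)
  finally show ?thesis by simp
qed

lemma valid_network_star:
  assumes "N \<ge> 1"
  shows "valid_network (star N)"
  unfolding valid_network_def
proof (intro conjI ballI)
  fix e assume "e \<in> edges (star N)"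
  then obtain i j where e: "e = {i, j}" "i \<le> N" "j \<le> N" "i \<noteq> j"
    by (auto simp: star_def)
  then show "\<exists>i\<in>verts (star N). \<exists>j\<in>verts (star N). i \<noteq> j \<and> e = {i, j}"
    by auto
  show "elen (star N) e > 0"
    using e by (auto simp: stem_def)
next
  fix u v assume "u \<in> verts (star N)" "v \<in> verts (star N)"
  then show "\<exists>w. walk_betw (star N) u v w"
    using short_walk_star[of u N v] by auto
next
  fix i j k assume "i \<in> verts (star N)" "j \<in> verts (star N)" "k \<in> verts (star N)"
  then show "cost (star N) i k \<le> cost (star N) i j + cost (star N) j k"
    using stem_simps(2)[of i] stem_simps(2)[of j] stem_simps(2)[of k]
    by (auto simp: cost_star simp del: stem_simps)
qed (use assms in auto)

text \<open>Leaving \<open>x\<close> costs its stem, and each node of \<open>xs\<close> costs 1.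
  With \<open>x = 0\<close> this builds tours; with the last node of a truck segment it bounds the
  second stage.\<close>

lemma star_return_walk:
  assumes "x \<le> N" "distinct (x # xs)" "set xs \<subseteq> {1..N}"
  shows "\<exists>w. walk_betw (star N) x 0 w \<and> set xs \<subseteq> set w \<and>
           walk_len (star N) w = stem x + real (length xs)"
proof (cases "x = 0 \<and> xs = []")
  case True
  then show ?thesis
    by (intro exI[of _ "[0]"]) (auto simp: walk_betw_def walk_star)
next
  case False
  let ?w = "x # xs @ [0]"
  have xs: "0 \<notin> set xs" using assms by auto
  have "last (x # xs) \<noteq> 0"
    using False xs by (metis last.simps last_in_set)
  then have "successively (\<noteq>) ((x # xs) @ [0])"
    using distinct_successively_neq[OF assms(2)] by (subst successively_append_iff) auto
  then have "successively (\<noteq>) ?w" by simp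
  then have w: "walk (star N) ?w"
    using assms by (auto simp: walk_star)
  then have "walk_len (star N) ?w = stem x + real (length xs)"
    using walk_len_star[OF w] xs by (simp add: sum_list_stem_const)
  with w show ?thesis
    by (intro exI[of _ ?w]) (auto simp: walk_betw_def)
qed

section \<open>The optimum with full information\<close>

text \<open>The list is cut into \<open>k\<close> consecutive blocks of at most \<open>c\<close>
  nodes, one tour for each; an empty block yields the walk that stays at the depot.\<close>

lemma star_cover:
  assumes "distinct xs" "set xs \<subseteq> {1..N}" "length xs \<le> k * c"
  shows "\<exists>ts. length ts = k \<and> set xs \<subseteq> visits ts \<and>
           (\<forall>w\<in>set ts. tour (star N) w \<and> walk_len (star N) w \<le> real c)"
  using assms
proof (induction k arbitrary: xs)
  case (Suc k)
  have "set (drop c xs) \<subseteq> {1..N}"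
    using Suc.prems set_drop_subset[of c xs] by blast
  then obtain ts where ts: "length ts = k" "set (drop c xs) \<subseteq> visits ts"
      "\<forall>w\<in>set ts. tour (star N) w \<and> walk_len (star N) w \<le> real c"
    using Suc.IH[of "drop c xs"] Suc.prems by (auto simp: le_diff_conv add.commute)
  have "set (take c xs) \<subseteq> {1..N}"
    using Suc.prems set_take_subset[of c xs] by blast
  then obtain w where "walk_betw (star N) 0 0 w" "set (take c xs) \<subseteq> set w"
      "walk_len (star N) w = stem 0 + real (length (take c xs))"
    using star_return_walk[of 0 N "take c xs"] Suc.prems by fastforce
  then show ?case
    using ts by (intro exI[of _ "w # ts"])
      (subst append_take_drop_id[of c xs, symmetric],
        auto simp: visits_def tour_def simp del: append_take_drop_id)
qed (auto simp: visits_def)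

text \<open>Below makespan \<open>b\<close> a drone tour has length below 1 and hence no stop, while
  a truck makes at most \<open>b - 1\<close> stops; since \<open>kt * (b - 1) < N\<close>, some node
  is missed. Makespan \<open>b\<close> is reached by an explicit family.\<close>

lemma OPT_star:
  assumes kt: "trucks (setting I) = kt" "kt \<ge> 1" and kd: "drones (setting I) = kd"
    and b: "speed (setting I) = 1 / real b" "b \<ge> 1"
    and G: "network (setting I) = star N" "kt * (b - 1) < N" "N \<le> kt * b + kd"
    and D: "damaged I \<subseteq> {1..N}" "card (damaged I) \<le> kt * b"
  shows "OPT I = real b"
proof -
  define feasible where "feasible F \<longleftrightarrow> family (star N) kt kd F \<and>
    {1..N} \<subseteq> visits (fst F) \<union> visits (snd F) \<and> damaged I \<subseteq> visits (fst F)" for F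
  let ?ms = "makespan (star N) (1 / real b)"
  have lower: "real b \<le> ?ms F" if F: "feasible F" for F
  proof (rule ccontr)
    assume "\<not> real b \<le> ?ms F"
    moreover have "set (fst F) \<noteq> {}"
      using F kt by (auto simp: feasible_def family_def)
    ultimately have truck: "\<And>w. w \<in> set (fst F) \<Longrightarrow> walk_len (star N) w < real b"
      and drone: "\<And>w. w \<in> set (snd F) \<Longrightarrow> walk_len (star N) w * real b < real b"
      by (auto simp: makespan_def not_le)
    have len: "real (card (set w - {0})) \<le> walk_len (star N) w"
      if "w \<in> set (fst F) \<union> set (snd F)" for w
      using F that by (intro star_tour_len_ge) (auto simp: feasible_def family_def tour_def)
    have "set w \<subseteq> {0}" if "w \<in> set (snd F)" for w
    proof -
      have "walk_len (star N) w < 1" using drone[OF that] b(2) by simp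
      then have "real (card (set w - {0})) < 1" using order.strict_trans1[OF len] that by blast
      then have "set w - {0} = {}"
        by simp
      then show ?thesis by auto
    qed
    then have "{1..N} \<subseteq> (\<Union>w\<in>set (fst F). set w - {0})"
      using F by (fastforce simp: feasible_def visits_def)
    then have "N \<le> card (\<Union>w\<in>set (fst F). set w - {0})"
      using card_mono[of "\<Union>w\<in>set (fst F). set w - {0}" "{1..N}"] by simp
    also have "\<dots> \<le> (\<Sum>w\<in>set (fst F). card (set w - {0}))"
      by (rule card_UN_le) simp
    also have "\<dots> \<le> (\<Sum>w\<in>set (fst F). b - 1)"
      using truck len by (intro sum_mono) force
    also have "\<dots> \<le> kt * (b - 1)"
      using F card_length[of "fst F"] by (simp add: feasible_def family_def)
    finally show False using G by simp
  qed
  have finD: "finite (damaged I)"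
    using D(1) finite_subset by blast
  \<comment> \<open>The damaged nodes come first, so they all lie among the first
    \<open>kt * b\<close> entries, which go to the trucks.\<close>
  define xs where "xs = sorted_list_of_set (damaged I) @ sorted_list_of_set ({1..N} - damaged I)"
  have xs: "distinct xs" "set xs = {1..N}"
    using D finD by (auto simp: xs_def)
  then have len: "length xs = N"
    using distinct_card by fastforce
  have damaged: "damaged I \<subseteq> set (take (kt * b) xs)"
    using D finD by (simp add: xs_def)
  obtain ts where ts: "length ts = kt" "set (take (kt * b) xs) \<subseteq> visits ts"
      "\<forall>w\<in>set ts. tour (star N) w \<and> walk_len (star N) w \<le> real b"
    using star_cover[of "take (kt * b) xs" N kt b] xs set_take_subset[of "kt * b" xs] by auto
  \<comment> \<open>At most \<open>kd\<close> nodes remain, one for each drone; a tour of length 1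
    at speed \<open>1 / b\<close> takes time \<open>b\<close>.\<close>
  obtain ds where ds: "length ds = kd" "set (drop (kt * b) xs) \<subseteq> visits ds"
      "\<forall>w\<in>set ds. tour (star N) w \<and> walk_len (star N) w \<le> real 1"
    using star_cover[of "drop (kt * b) xs" N kd 1] xs len G set_drop_subset[of "kt * b" xs]
    by (auto simp: le_diff_conv add.commute)
  have "{1..N} = set (take (kt * b) xs) \<union> set (drop (kt * b) xs)"
    using xs(2) by (metis append_take_drop_id set_append)
  then have feas: "feasible (ts, ds)"
    using ts ds damaged by (auto simp: feasible_def family_def)
  moreover have "walk_len (star N) w * real b \<le> real b" if "w \<in> set ds" for w
    using mult_right_mono[of "walk_len (star N) w" 1 "real b"] ds that by simp
  then have "?ms (ts, ds) \<le> real b"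
    using ts kt by (auto simp: makespan_def intro!: Max.boundedI)
  ultimately have "?ms (ts, ds) = real b"
    using lower by (meson antisym)
  then have "(LEAST T. \<exists>F. feasible F \<and> T = ?ms F) = real b"
    using feas lower by (intro Least_equality) (metis, blast)
  moreover have "OPT I = (LEAST T. \<exists>F. feasible F \<and> T = ?ms F)"
    unfolding OPT_def Let_def feasible_def conj_assoc kt(1) kd b(1) G(1) star_sel ..
  ultimately show ?thesis by simp
qed

section \<open>The first stage on the star\<close>

lemma seq_len_star_cycle_realized:
  assumes "realizes (star N) w (0 # xs @ [0])" "distinct xs" "set xs \<subseteq> {1..N}"
  shows "walk_len (star N) w = real (length xs)"
  using assms by (simp add: realizes_star seq_len_star_cycle)

lemma first_stage_star:
  assumes "first_stage S P" "network S = star N" "i < trucks S"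
  shows "distinct (listing P ! i)" "set (listing P ! i) \<subseteq> {1..N}"
    and "is_arg_min (splitting_cost (star N) (speed S))
           (splitting (1 + drone_num P ! i) (listing P ! i)) (segments P ! i)"
    and "realizes (star N) (truck_out P ! i) (0 # truck_segment (segments P ! i))"
    and "list_all2 (\<lambda>w s. realizes (star N) w (0 # rev s @ [0]))
           (drone_walks P ! i) (drone_segments (segments P ! i))"
proof -
  have *: "i < length (listing P)" "distinct (concat (listing P))"
      "set (concat (listing P)) = {1..N}"
    using assms by (auto simp: first_stage_def Let_def)
  show "distinct (listing P ! i)"
    using * by (simp add: distinct_concat_iff)
  show "set (listing P ! i) \<subseteq> {1..N}"
    using * nth_mem[of i "listing P"] by auto
qed (use assms in \<open>auto simp: first_stage_def Let_def\<close>)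

text \<open>The listed tours have minimum makespan, so none is longer than the longest tour of the
  balanced family from \<open>star_cover\<close>.\<close>

lemma first_stage_star_length_le:
  assumes P: "first_stage S P" and S: "network S = star N" "i < trucks S"
    and N: "N \<le> trucks S * c"
  shows "length (listing P ! i) \<le> c"
proof -
  obtain ts where opt: "optimal_family (star N) (speed S) (trucks S) 0 {1..N} (ts, [])"
      and ts: "realizes (star N) (ts ! i) (0 # listing P ! i @ [0])"
    using P S by (auto simp: first_stage_def Let_def)
  obtain us where us: "length us = trucks S" "{1..N} \<subseteq> visits us"
      "\<forall>w\<in>set us. tour (star N) w \<and> walk_len (star N) w \<le> real c"
    using star_cover[of "[1..<Suc N]" N "trucks S" c] N
    by (auto simp: atLeastLessThanSuc_atLeastAtMost simp del: upt_Suc)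
  have len: "length ts = trucks S"
    using opt by (simp add: optimal_family_def is_arg_min_def family_def)
  have "real (length (listing P ! i)) = walk_len (star N) (ts ! i)"
    using seq_len_star_cycle_realized[OF ts] first_stage_star[OF P S] by simp
  also have "\<dots> \<le> makespan (star N) (speed S) (ts, [])"
    using len S by (auto simp: makespan_def)
  also have "\<dots> \<le> makespan (star N) (speed S) (us, [])"
    using opt us by (auto simp: optimal_family_def is_arg_min_linorder family_def visits_def)
  also have "\<dots> \<le> real c"
    using us S by (auto simp: makespan_def intro!: Max.boundedI)
  finally show ?thesis by simp
qed

text \<open>Pigeonhole: the listings partition the \<open>N\<close> nodes into
  \<open>trucks S\<close> lists.\<close>

lemma first_stage_star_long_tour:
  assumes P: "first_stage S P" and S: "network S = star N" and N: "trucks S * c < N"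
  shows "\<exists>i<trucks S. c < length (listing P ! i)"
proof (rule ccontr)
  assume "\<not> ?thesis"
  moreover have *: "length (listing P) = trucks S" "distinct (concat (listing P))"
      "set (concat (listing P)) = {1..N}"
    using P S by (auto simp: first_stage_def Let_def)
  ultimately have "sum_list (map length (listing P)) \<le> sum_list (map (\<lambda>_. c) (listing P))"
    by (intro sum_list_mono) (metis in_set_conv_nth not_less)
  moreover have "length (concat (listing P)) = N"
    using * distinct_card[of "concat (listing P)"] by simp
  ultimately show False
    using N * by (simp add: length_concat sum_list_triv)
qed

lemma truck_segment_append:
  assumes "splitting k vs \<Delta>"
  shows "truck_segment \<Delta> @ concat (drone_segments \<Delta>) = vs"
    and "vs \<noteq> [] \<Longrightarrow> truck_segment \<Delta> \<noteq> []"
  using assms by (auto simp: splitting_def truck_segment_def drone_segments_def split: list.splits)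

lemma first_stage_star_drone_time:
  assumes P: "first_stage S P" and S: "network S = star N" "i < trucks S" "speed S > 0"
    and w: "w \<in> set (drone_walks P ! i)"
  shows "walk_len (star N) w / speed S \<le> real (length (listing P ! i))"
proof -
  let ?vs = "listing P ! i" and ?\<Delta> = "segments P ! i"
  note fs = first_stage_star[OF P S(1,2)]
  have split: "splitting (1 + drone_num P ! i) ?vs ?\<Delta>"
    using fs(3) by (simp add: is_arg_min_def)
  obtain s where s: "s \<in> set (drone_segments ?\<Delta>)" "realizes (star N) w (0 # rev s @ [0])"
    using fs(5) w by (metis in_set_conv_nth list_all2_conv_all_nth)
  have "?vs \<noteq> []"
    using split s
    by (cases ?\<Delta>) (auto simp: splitting_def drone_segments_def)
  \<comment> \<open>The competitor leaves the whole tour to the truck, at cost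
    \<open>length ?vs\<close>; the chosen splitting is no worse.\<close>
  then have "splitting (1 + drone_num P ! i) ?vs [?vs]"
    by (simp add: splitting_def)
  have "walk_len (star N) w / speed S \<le> splitting_cost (star N) (speed S) ?\<Delta>"
    unfolding splitting_cost_def realizes_star[OF s(2)]
    using s by (intro Max_ge) auto
  also have "\<dots> \<le> splitting_cost (star N) (speed S) [?vs]"
    using fs(3) \<open>splitting _ _ [?vs]\<close> by (simp add: is_arg_min_linorder)
  also have "\<dots> = real (length ?vs)"
    using fs by (simp add: splitting_cost_def truck_segment_def drone_segments_def seq_len_star_cycle)
  finally show ?thesis .
qed

section \<open>The second stage on the star\<close>

lemma walk_len_take_le:
  assumes "\<And>e. 0 \<le> elen G e"
  shows "walk_len G (take n w) \<le> walk_len G w"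
proof (induction w arbitrary: n rule: induct_list012)
  case (3 x y zs)
  have nonneg: "0 \<le> walk_len G u" for u
    by (induction u rule: induct_list012) (auto simp: assms)
  show ?case
  proof (cases n)
    case (Suc m)
    then show ?thesis
      using 3(2)[of m] assms[of "{x, y}"] nonneg[of "y # zs"] by (cases m) auto
  qed (use nonneg[of "x # y # zs"] in simp)
qed (auto simp: take_Cons')

text \<open>The replanning time is the length of the entire outward walk, and every prefix of it is
  at most that long.\<close>

lemma truck_out_visited:
  assumes "i < trucks (setting I)" "\<And>e. 0 \<le> elen (network (setting I)) e"
  shows "set (truck_out (first R (setting I)) ! i) \<subseteq> visited_at_replan R I i"
proof -
  let ?w = "truck_out (first R (setting I)) ! i"
  have "set ?w \<subseteq> visited_until (network (setting I)) 1 (replan_time R (setting I) i) ?w"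
    using walk_len_take_le[OF assms(2)]
    by (auto simp: visited_until_def replan_time_def in_set_conv_nth)
  then show ?thesis
    using assms(1) by (subst visited_at_replan.simps) (auto simp: Let_def)
qed

text \<open>Going out along the truck segment and then through all remaining nodes home takes
  \<open>length vs\<close>, and the optimal return is no longer. If every node off the outward walk
  is damaged, the full walk is a tour through all of \<open>vs\<close>, hence no shorter. A nonempty
  truck segment puts at least one node on the outward walk.\<close>

lemma truck_star:
  assumes P: "first_stage (setting I) (first R (setting I))" "second_stage R I i"
    and S: "network (setting I) = star N" "i < trucks (setting I)"
  defines "vs \<equiv> listing (first R (setting I)) ! i"
    and "u \<equiv> truck_out (first R (setting I)) ! i"
  shows "walk_len (star N) (u @ tl (second_walk R I i)) \<le> real (length vs)"
    and "set vs - set u \<subseteq> damaged I \<Longrightarrow>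
      real (length vs) \<le> walk_len (star N) (u @ tl (second_walk R I i))"
    and "vs \<noteq> [] \<Longrightarrow> card (set vs - set u) < length vs"
proof -
  let ?\<Delta> = "segments (first R (setting I)) ! i"
  define s where "s = truck_segment ?\<Delta>"
  define rest where "rest = concat (drone_segments ?\<Delta>)"
  let ?w = "second_walk R I i" and ?M = "missing_damaged R I i \<union> missing_unvisited R I i"
  note fs = first_stage_star[OF P(1) S, folded vs_def u_def s_def]
  have split: "splitting (1 + drone_num (first R (setting I)) ! i) vs ?\<Delta>"
    using fs(3) by (simp add: is_arg_min_def)
  have vs: "vs = s @ rest" and s: "vs \<noteq> [] \<Longrightarrow> s \<noteq> []"
    unfolding s_def rest_def
    using truck_segment_append(1)[OF split] truck_segment_append(2)[OF split] by simp_all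
  have "0 \<notin> set rest" "set (0 # s) \<subseteq> {..N}" "set s \<inter> set rest = {}"
    using fs(1,2) vs by auto
  \<comment> \<open>Writing \<open>last (0 # s)\<close> covers the empty segment too: the truck then
    replans at the depot.\<close>
  then have last: "last (0 # s) \<le> N" "last (0 # s) \<notin> set rest"
    using last_in_set[of "0 # s"] by auto
  \<comment> \<open>The stem still to be paid for leaving the last node completes one unit for each
    node of \<open>s\<close>.\<close>
  have len: "walk_len (star N) u + stem (last (0 # s)) = real (length s)"
  proof (cases "s = []")
    case True
    then show ?thesis using realizes_star[OF fs(4)] by (simp add: seq_len_def)
  next
    case False
    then have "last s \<in> set vs" using vs by simp
    then have "last s \<noteq> 0" using fs(2) by (auto simp: subset_iff)
    then show ?thesis
      using False realizes_star[OF fs(4)] seq_len_star_path[of s N] fs(1,2) vs by (simp add: stem_def)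
  qed
  have u: "walk_betw (star N) 0 (last (0 # s)) u" and s_u: "set (0 # s) \<subseteq> set u"
    using realizes_walk[OF fs(4)] by auto
  have elen_nonneg: "0 \<le> elen (network (setting I)) e" for e
    using S by (simp add: star_def sum_nonneg)
  have w: "walk_betw (star N) (last u) 0 ?w" "?M \<subseteq> set ?w"
    and min: "\<And>w'. walk_betw (star N) (last u) 0 w' \<Longrightarrow> ?M \<subseteq> set w' \<Longrightarrow>
      walk_len (star N) ?w \<le> walk_len (star N) w'"
    using P(2) S by (auto simp: second_stage_def Let_def is_arg_min_linorder u_def)
  have last_u: "last u = last (0 # s)"
    using u by (simp add: walk_betw_def)
  have join: "walk_len (star N) (u @ tl ?w) = walk_len (star N) u + walk_len (star N) ?w"
    using u w(1) by (intro walk_len_join) (auto simp: walk_betw_def walk_def)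
  have "?M \<subseteq> set vs - set u"
    using truck_out_visited[OF S(2) elen_nonneg, of R]
    by (auto simp: missing_damaged_def missing_unvisited_def Let_def vs_def u_def)
  then have M: "?M \<subseteq> set rest"
    using vs s_u by auto
  have rest: "distinct (last (0 # s) # rest)" "set rest \<subseteq> {1..N}"
    using last fs(1,2) vs by auto
  \<comment> \<open>The competitor visits all of \<open>rest\<close>, whichever of these nodes are
    missing.\<close>
  obtain w' where w': "walk_betw (star N) (last u) 0 w'" "set rest \<subseteq> set w'"
      "walk_len (star N) w' = stem (last (0 # s)) + real (length rest)"
    unfolding last_u using star_return_walk[OF last(1) rest] by blast
  then show "walk_len (star N) (u @ tl ?w) \<le> real (length vs)"
    using min[OF w'(1) subset_trans[OF M w'(2)]] w'(3) join len vs by simp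
  show "card (set vs - set u) < length vs" if "vs \<noteq> []"
  proof -
    have "set vs - set u \<subset> set vs"
      using hd_in_set[OF s[OF that]] s_u vs by auto
    then show ?thesis
      by (meson List.finite_set card_length order.strict_trans2 psubset_card_mono)
  qed
  show "real (length vs) \<le> walk_len (star N) (u @ tl ?w)" if "set vs - set u \<subseteq> damaged I"
  proof -
    note tour = walk_join[OF u w(1)[unfolded last_u]]
    have "set vs - set u \<subseteq> ?M"
      using that by (auto simp: missing_damaged_def Let_def vs_def u_def)
    then have "set vs \<subseteq> set (u @ tl ?w) - {0}"
      using w(2) fs(2) unfolding tour(2) by auto
    then have "card (set vs) \<le> card (set (u @ tl ?w) - {0})"
      by (intro card_mono) auto
    then show ?thesis
      using star_tour_len_ge[OF tour(1)] fs(1) by (simp add: distinct_card)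
  qed
qed

section \<open>The instance and its ratio\<close>

theorem lemma22:
  fixes R :: "nat policy" and \<alpha> :: real and b kt kd :: nat
  assumes "regretless_policy R"
    and "b \<ge> 1" and "\<alpha> = 1 / real b"
    and "kt \<ge> 1" and "kd \<ge> 1"
    and "int kt \<ge> \<lceil>real kd / real kt\<rceil> + int b - 1"
  shows "\<exists>I :: nat rdp_instance. valid_instance I \<and>
           trucks (setting I) = kt \<and> drones (setting I) = kd \<and> speed (setting I) = \<alpha> \<and>
           Regretless R I / OPT I = 1 + \<alpha> * real_of_int \<lceil>real kd / real kt\<rceil>"
proof -
  define m where "m = nat \<lceil>real kd / real kt\<rceil>"
  have "\<lceil>real kd / real kt\<rceil> \<ge> 1"
    using assms by simp
  then have m: "\<lceil>real kd / real kt\<rceil> = int m" "m \<ge> 1"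
    unfolding m_def by linarith+
  \<comment> \<open>The ceiling exceeds \<open>kd / kt\<close> by less than 1; the resulting
    \<open>kt * (m - 1) < kd\<close> lets the trucks and drones cover all nodes within time
    \<open>b\<close>.\<close>
  have "real (m - 1) < real kd / real kt"
    using m by linarith
  then have "real (kt * (m - 1)) < real kd"
    using assms by (simp add: field_simps)
  then have kd: "kt * (m - 1) < kd"
    by (simp only: of_nat_less_iff)
  define c where "c = b + m"
  \<comment> \<open>One node more than \<open>kt\<close> trucks can serve with \<open>c - 1\<close>
    stops each, so some listed tour has exactly \<open>c\<close> nodes.\<close>
  define N where "N = kt * (c - 1) + 1"
  have c: "c - 1 = b + (m - 1)" "c - 1 \<le> kt" "1 \<le> c" "b - 1 \<le> c - 1"
    using m assms by (auto simp: c_def)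
  have N: "N \<le> kt * c" "N \<le> kt * b + kd" "kt * (b - 1) < N" "N \<ge> 1"
  proof -
    have "kt * (b - 1) \<le> kt * (c - 1)"
      using c by (intro mult_le_mono2) simp
    then show "kt * (b - 1) < N" "N \<ge> 1"
      unfolding N_def by linarith+
    have "kt * c = kt * (c - 1) + kt"
      using c(3) by (cases c) auto
    then show "N \<le> kt * c"
      using assms(4) by (simp add: N_def)
    show "N \<le> kt * b + kd"
      using kd unfolding N_def c(1) by (simp add: add_mult_distrib2)
  qed
  define S :: "nat setting"
    where "S = \<lparr>trucks = kt, drones = kd, speed = \<alpha>, network = star N\<rparr>"
  have S [simp]: "trucks S = kt" "drones S = kd" "speed S = \<alpha>" "network S = star N"
    by (simp_all add: S_def)
  have \<alpha>: "\<alpha> > 0"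
    using assms by simp
  have "valid_setting S"
    using assms N valid_network_star by (simp add: valid_setting_def)
  then have P: "first_stage S (first R S)"
    using assms(1) by (simp add: regretless_policy_def)
  let ?P = "first R S"
  have short: "length (listing ?P ! i) \<le> c" if "i < kt" for i
    using first_stage_star_length_le[OF P] that N by simp
  obtain i where i: "i < kt" "c - 1 < length (listing ?P ! i)"
    using first_stage_star_long_tour[OF P, of N "c - 1"] by (auto simp: N_def)
  then have i_len: "length (listing ?P ! i) = c"
    using short[of i] by simp
  \<comment> \<open>Not circular: the plan \<open>first R S\<close> depends on the setting alone, so
    the damage may be chosen after it.\<close>
  define D where "D = set (listing ?P ! i) - set (truck_out ?P ! i)"
  define I where "I = \<lparr>setting = S, damaged = D\<rparr>"
  have I [simp]: "setting I = S" "damaged I = D"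
    by (simp_all add: I_def)
  have D: "D \<subseteq> {1..N}"
    using first_stage_star(2)[OF P] i by (auto simp: D_def)
  with \<open>valid_setting S\<close> have valid: "valid_instance I"
    by (simp add: valid_instance_def)
  then have second: "second_stage R I j" if "j < kt" for j
    using assms(1) that by (simp add: regretless_policy_def)
  note truck = truck_star[of I R, unfolded I S, OF P second refl]
  have "listing ?P ! i \<noteq> []"
    using i(2) by auto
  then have "card D < c"
    using truck(3)[OF i(1) i(1)] unfolding D_def i_len by blast
  \<comment> \<open>Here the hypothesis on \<open>kt\<close> enters, as
    \<open>c - 1 \<le> kt\<close>: the damaged nodes fit on the trucks.\<close>
  then have "card D \<le> kt * b"
    using c(2) assms(2) mult_le_mono2[of 1 b kt] by linarith
  then have OPT: "OPT I = real b"
    using OPT_star[of I kt kd b N] assms(2-4) D N(2,3) by simp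
  have "Regretless R I = real c"
  proof -
    let ?A = "(\<lambda>j. walk_len (star N) (truck_out ?P ! j @ tl (second_walk R I j))) ` {..<kt} \<union>
      (\<lambda>w. walk_len (star N) w / \<alpha>) ` (\<Union>j<kt. set (drone_walks ?P ! j))"
    have "t \<le> real c" if "t \<in> ?A" for t
      using that
    proof (elim UnE imageE UN_E)
      fix j assume "t = walk_len (star N) (truck_out ?P ! j @ tl (second_walk R I j))" "j \<in> {..<kt}"
      then show ?thesis
        using order_trans[OF truck(1)[of j]] short[of j] by simp
    next
      fix w j assume "t = walk_len (star N) w / \<alpha>" "j \<in> {..<kt}" "w \<in> set (drone_walks ?P ! j)"
      then show ?thesis
        using order_trans[OF first_stage_star_drone_time[OF P, of N j w]] short[of j] \<alpha> by simp
    qed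
    \<comment> \<open>Truck \<open>i\<close> attains the bound \<open>c\<close> since all nodes off
      its outward walk are damaged.\<close>
    moreover have "walk_len (star N) (truck_out ?P ! i @ tl (second_walk R I i)) = real c"
      using truck(1,2)[OF i(1) i(1)] i_len D_def by (simp add: order_antisym)
    then have "real c \<in> ?A"
      using i(1) by (intro UnI1 image_eqI[of _ _ i]) auto
    ultimately have "Max ?A = real c"
      by (intro Max_eqI) auto
    then show ?thesis
      by (simp add: Regretless_def Let_def)
  qed
  then have "Regretless R I / OPT I = 1 + \<alpha> * real_of_int \<lceil>real kd / real kt\<rceil>"
    using OPT m assms by (simp add: c_def field_simps)
  with valid show ?thesis
    by (intro exI[of _ I]) simp
qed

end
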